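(* Let $q$ be a prime power and $n\ge1$. If $D\in\mathscr{D}_n(\mathbb{F}_{q^n})$ is a Dickson matrix, then its adjugate matrix $D^\star$ is also a Dickson matrix, i.e. $D^\star\in\mathscr{D}_n(\mathbb{F}_{q^n})$.
   Context: $\mathscr{D}_n(\mathbb{F}_{q^n})$ is the set of Dickson matrices, i.e. $n\times n$ matrices over $\mathbb{F}_{q^n}$ of the form $\left(a_{j-i}^{q^i}\right)_{0\le i,j\le n-1}$ (the $(i,j)$ entry is $a_{j-i}^{q^i}$, subscripts reduced modulo $n$) with $a_0,\dots,a_{n-1}\in\mathbb{F}_{q^n}$. For a square matrix $N$, $N^\star$ denotes its adjugate, i.e. the transpose of its cofactor matrix. *)

theory Defs
  imports "HOL-Library.Cardinality" "HOL-Number_Theory.Prime_Powers" "Jordan_Normal_Form.Determinant"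
begin

(* For i, j < n the index (j + n - i) mod n is j - i reduced modulo n; adding n first avoids
   truncated subtraction. The intended field is one with q ^ n elements. *)
definition dickson_mat :: "nat \<Rightarrow> nat \<Rightarrow> (nat \<Rightarrow> 'a :: field) \<Rightarrow> 'a mat" where
  "dickson_mat q n a = mat n n (\<lambda>(i, j). a ((j + n - i) mod n) ^ (q ^ i))"

(* Only the values a 0, ..., a (n - 1) are used. *)
definition dickson_matrices :: "nat \<Rightarrow> nat \<Rightarrow> 'a :: field mat set" where
  "dickson_matrices q n = range (dickson_mat q n)"

end

theory Submission
  imports Defs "HOL-Number_Theory.Residues"
begin

text \<open>
  Write \<open>\<phi>\<close> for the Frobenius map \<open>x \<mapsto> x ^ q\<close>. Each row of a Dickson matrix is the image
  under \<open>\<phi>\<close> of the row above it, moved one place to the right cyclically; as \<open>\<phi>\<close> has order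
  dividing \<open>n\<close> on a field with \<open>q ^ n\<close> elements, this also holds from the last row to the first.
  Hence the Dickson matrices are exactly the matrices for which cyclically shifting rows and
  columns by one has the same effect as applying \<open>\<phi>\<close> to every entry
  (\<open>dickson_matrices_iff_reindex_eq_frobenius\<close>).

  Both operations commute with the adjugate. A simultaneous permutation of rows and columns is
  conjugation by a permutation matrix (\<open>adj_mat_reindex\<close>), and \<open>\<phi>\<close> is a ring homomorphism, so it
  commutes with the determinants that make up the adjugate (\<open>comm_ring_hom.adj_mat_map_mat\<close>).
  The adjugate therefore satisfies the equation that characterises Dickson matrices.
\<close>

section \<open>The adjugate under permutations and homomorphisms\<close>

definition reindex_mat :: "(nat \<Rightarrow> nat) \<Rightarrow> 'a mat \<Rightarrow> 'a mat" where
  "reindex_mat p A = mat (dim_row A) (dim_col A) (\<lambda>(i, j). A $$ (p i, p j))"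

lemma reindex_mat_carrier: "A \<in> carrier_mat m n \<Longrightarrow> reindex_mat p A \<in> carrier_mat m n"
  by (auto simp: reindex_mat_def)

text \<open>
  The rows and the columns each contribute the sign of \<open>p\<close>, and the two signs cancel.
\<close>
lemma det_reindex_mat:
  fixes A :: "'a :: comm_ring_1 mat"
  assumes A: "A \<in> carrier_mat n n" and p: "p permutes {0..<n}"
  shows "det (reindex_mat p A) = det A"
proof -
  define B where "B = mat n n (\<lambda>(i, j). A $$ (p i, j))"
  have B: "B \<in> carrier_mat n n"
    by (simp add: B_def)
  have p_lt: "p i < n" if "i < n" for i
    using permutes_in_image[OF p, of i] that by simp
  have "det (reindex_mat p A) = det (transpose_mat (reindex_mat p A))"
    by (rule det_transpose[symmetric, OF reindex_mat_carrier[OF A]])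
  also have "transpose_mat (reindex_mat p A) = mat n n (\<lambda>(i, j). transpose_mat B $$ (p i, j))"
    using A by (intro eq_matI) (auto simp: reindex_mat_def B_def p_lt)
  also have "det \<dots> = signof p * det B"
    using det_permute_rows[OF _ p, of "transpose_mat B"] det_transpose[OF B] B by simp
  also have "det B = signof p * det A"
    unfolding B_def by (rule det_permute_rows[OF A p])
  also have "signof p * (signof p * det A) = det A"
    by (simp add: sign_def)
  finally show ?thesis .
qed

text \<open>
  Replacing a row by a unit vector turns a cofactor into a determinant of full size. In this form
  it can be permuted and mapped without tracking which row and column have been deleted.
\<close>
definition unit_row_mat :: "'a :: comm_ring_1 mat \<Rightarrow> nat \<Rightarrow> nat \<Rightarrow> 'a mat" where
  "unit_row_mat A i j =
     mat (dim_row A) (dim_col A) (\<lambda>(k, l). if k = i then if l = j then 1 else 0 else A $$ (k, l))"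

lemma cofactor_eq_det_unit_row_mat:
  assumes A: "A \<in> carrier_mat n n" and i: "i < n" and j: "j < n"
  shows "cofactor A i j = det (unit_row_mat A i j)"
proof -
  let ?U = "unit_row_mat A i j"
  have U: "?U \<in> carrier_mat n n"
    using A by (simp add: unit_row_mat_def)
  have del: "mat_delete ?U i l = mat_delete A i l" for l
    using A i by (intro eq_matI) (auto simp: mat_delete_def unit_row_mat_def)
  have cof: "cofactor ?U i l = cofactor A i l" for l
    by (simp add: cofactor_def del)
  have "det ?U = (\<Sum>l<n. ?U $$ (i, l) * cofactor ?U i l)"
    by (rule laplace_expansion_row[OF U i])
  also have "\<dots> = (\<Sum>l<n. if l = j then cofactor A i l else 0)"
    unfolding cof using A i by (intro sum.cong refl) (auto simp: unit_row_mat_def)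
  also have "\<dots> = cofactor A i j"
    using j by simp
  finally show ?thesis ..
qed

lemma adj_mat_reindex:
  fixes A :: "'a :: comm_ring_1 mat"
  assumes A: "A \<in> carrier_mat n n" and p: "p permutes {0..<n}"
  shows "adj_mat (reindex_mat p A) = reindex_mat p (adj_mat A)"
proof (rule eq_matI)
  have p_lt: "p i < n" if "i < n" for i
    using permutes_in_image[OF p, of i] that by simp
  have p_eq: "p i = p j \<longleftrightarrow> i = j" for i j
    using permutes_inj[OF p] by (auto dest: injD)
  fix i j assume "i < dim_row (reindex_mat p (adj_mat A))" "j < dim_col (reindex_mat p (adj_mat A))"
  hence i: "i < n" and j: "j < n"
    using A by (auto simp: reindex_mat_def adj_mat_def)
  have "unit_row_mat (reindex_mat p A) j i = reindex_mat p (unit_row_mat A (p j) (p i))"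
    using A by (intro eq_matI) (auto simp: unit_row_mat_def reindex_mat_def p_lt p_eq)
  moreover have "unit_row_mat A (p j) (p i) \<in> carrier_mat n n"
    using A by (simp add: unit_row_mat_def)
  ultimately have "cofactor (reindex_mat p A) j i = cofactor A (p j) (p i)"
    using A i j
    by (simp add: cofactor_eq_det_unit_row_mat[of _ n] reindex_mat_carrier p_lt
        det_reindex_mat[OF _ p])
  thus "adj_mat (reindex_mat p A) $$ (i, j) = reindex_mat p (adj_mat A) $$ (i, j)"
    using A i j by (simp add: adj_mat_def reindex_mat_def p_lt)
qed (use A in \<open>auto simp: adj_mat_def reindex_mat_def\<close>)

lemma (in comm_ring_hom) adj_mat_map_mat:
  assumes A: "A \<in> carrier_mat n n"
  shows "adj_mat (map_mat hom A) = map_mat hom (adj_mat A)"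
proof (rule eq_matI)
  fix i j assume "i < dim_row (map_mat hom (adj_mat A))" "j < dim_col (map_mat hom (adj_mat A))"
  hence i: "i < n" and j: "j < n"
    using A by (auto simp: adj_mat_def)
  have "unit_row_mat (map_mat hom A) j i = map_mat hom (unit_row_mat A j i)"
    using A by (intro eq_matI) (auto simp: unit_row_mat_def)
  hence "cofactor (map_mat hom A) j i = hom (cofactor A j i)"
    using A i j by (simp add: cofactor_eq_det_unit_row_mat[of _ n])
  thus "adj_mat (map_mat hom A) $$ (i, j) = map_mat hom (adj_mat A) $$ (i, j)"
    using A i j by (simp add: adj_mat_def)
qed (auto simp: adj_mat_def)

section \<open>The Frobenius map of a finite field\<close>

text \<open>
  Multiplication by a nonzero \<open>x\<close> permutes the nonzero elements, so it does not change their
  product, which is itself nonzero.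
\<close>
lemma power_card_field:
  fixes x :: "'a :: {field, finite}"
  shows "x ^ CARD('a) = x"
proof (cases "x = 0")
  case False
  let ?P = "\<Prod>y\<in>UNIV - {0 :: 'a}. y"
  have "bij_betw ((*) x) (UNIV - {0}) (UNIV - {0})"
    by (rule bij_betw_byWitness[where f' = "\<lambda>y. y / x"]) (use False in auto)
  hence "?P = (\<Prod>y\<in>UNIV - {0}. x * y)"
    by (rule prod.reindex_bij_betw[symmetric])
  also have "\<dots> = x ^ (CARD('a) - 1) * ?P"
    by (simp add: prod.distrib)
  finally have "x ^ (CARD('a) - 1) = 1"
    by simp
  moreover have "CARD('a) = Suc (CARD('a) - 1)"
    by (simp add: finite_UNIV_card_ge_0)
  ultimately show ?thesis
    by (metis mult.right_neutral power_Suc)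
qed (simp add: finite_UNIV_card_ge_0)

text \<open>
  The characteristic divides the number of elements of the field, a power of the prime below
  \<open>q\<close>, so it is that prime, and additivity is the freshman's dream.
\<close>
lemma frobenius_comm_ring_hom:
  fixes q n :: nat
  assumes q: "primepow q" and card: "CARD('a :: {field, finite}) = q ^ n"
  shows "comm_ring_hom (\<lambda>x :: 'a. x ^ q)"
proof -
  obtain p k where p: "prime p" and qpk: "q = p ^ k" and k: "k > 0"
    using q by (auto simp: primepow_def)
  have char: "prime CHAR('a)"
    by (intro prime_CHAR_semidom finite_imp_CHAR_pos) simp
  have "CHAR('a) dvd p ^ (k * n)"
    using CHAR_dvd_CARD[where ?'a = 'a] card qpk by (simp add: power_mult)
  hence "CHAR('a) = p"
    using char p by (metis prime_dvd_power primes_dvd_imp_eq)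
  hence "(x + y) ^ q = x ^ q + y ^ q" for x y :: 'a
    using freshmans_dream'[OF char] qpk by metis
  moreover have "q > 0"
    using primepow_gt_0_nat[OF q] .
  ultimately show ?thesis
    by unfold_locales (auto simp: power_mult_distrib)
qed

section \<open>Dickson matrices\<close>

definition cyclic_succ :: "nat \<Rightarrow> nat \<Rightarrow> nat" where
  "cyclic_succ n i = (if i < n then Suc i mod n else i)"

lemma cyclic_succ_less: "i < n \<Longrightarrow> cyclic_succ n i < n"
  by (simp add: cyclic_succ_def)

lemma cyclic_succ_permutes: "cyclic_succ n permutes {0..<n}"
proof (rule bij_imp_permutes)
  have "inj_on (cyclic_succ n) {0..<n}"
    by (auto simp: inj_on_def cyclic_succ_def mod_Suc split: if_splits)
  moreover have "cyclic_succ n ` {0..<n} \<subseteq> {0..<n}"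
    by (auto simp: cyclic_succ_less)
  ultimately show "bij_betw (cyclic_succ n) {0..<n} {0..<n}"
    by (simp add: bij_betw_def endo_inj_surj)
qed (simp add: cyclic_succ_def)

text \<open>The residue of \<open>j - i\<close> modulo \<open>n\<close> is invariant under a common cyclic shift.\<close>
lemma cyclic_succ_diff:
  assumes "i < n" "j < n"
  shows "(cyclic_succ n j + n - cyclic_succ n i) mod n = (j + n - i) mod n"
proof (cases "Suc i = n")
  case i: True
  show ?thesis
  proof (cases "Suc j = n")
    case True
    hence "j = i"
      using i by simp
    thus ?thesis
      using assms i by (simp add: cyclic_succ_def)
  next
    case False
    hence "cyclic_succ n j = Suc j" "cyclic_succ n i = 0" "j + n - i = Suc j"
      using assms i by (auto simp: cyclic_succ_def)
    thus ?thesis by (simp only: diff_zero mod_add_self2)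
  qed
next
  case i: False
  show ?thesis
  proof (cases "Suc j = n")
    case True
    hence "cyclic_succ n j = 0" "cyclic_succ n i = Suc i" "j + n - i = n + (n - Suc i)"
      using assms i by (auto simp: cyclic_succ_def)
    thus ?thesis by simp
  next
    case False
    thus ?thesis using assms i by (simp add: cyclic_succ_def)
  qed
qed

text \<open>
  The relation between consecutive rows determines a matrix from its first row, which serves as
  the family \<open>a\<close>. The wrap-around from the last row to the first is the only place where
  \<open>x ^ (q ^ n) = x\<close> enters.
\<close>
lemma dickson_matrices_iff_reindex_eq_frobenius:
  fixes M :: "'a :: field mat"
  assumes n: "n \<ge> 1" and frob: "\<And>x :: 'a. x ^ (q ^ n) = x"
  shows "M \<in> dickson_matrices q n \<longleftrightarrow>
    M \<in> carrier_mat n n \<and> reindex_mat (cyclic_succ n) M = map_mat (\<lambda>x. x ^ q) M"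
proof (intro iffI conjI)
  assume "M \<in> dickson_matrices q n"
  then obtain a where M: "M = dickson_mat q n a"
    by (auto simp: dickson_matrices_def)
  show "M \<in> carrier_mat n n"
    by (simp add: M dickson_mat_def)
  have "M $$ (cyclic_succ n i, cyclic_succ n j) = (M $$ (i, j)) ^ q" if "i < n" "j < n" for i j
  proof -
    let ?x = "a ((j + n - i) mod n)"
    have "?x ^ q ^ cyclic_succ n i = ?x ^ q ^ Suc i"
    proof (cases "Suc i = n")
      case True
      hence "cyclic_succ n i = 0"
        by (auto simp: cyclic_succ_def)
      thus ?thesis unfolding True frob by simp
    next
      case False
      thus ?thesis using that by (simp add: cyclic_succ_def)
    qed
    thus ?thesis
      using that
      by (simp add: M dickson_mat_def cyclic_succ_less cyclic_succ_diff mult.commute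
          flip: power_mult)
  qed
  thus "reindex_mat (cyclic_succ n) M = map_mat (\<lambda>x. x ^ q) M"
    by (intro eq_matI) (auto simp: reindex_mat_def M dickson_mat_def)
next
  assume "M \<in> carrier_mat n n \<and> reindex_mat (cyclic_succ n) M = map_mat (\<lambda>x. x ^ q) M"
  hence M: "M \<in> carrier_mat n n" and eq: "reindex_mat (cyclic_succ n) M = map_mat (\<lambda>x. x ^ q) M"
    by auto
  have step: "M $$ (cyclic_succ n i, cyclic_succ n j) = (M $$ (i, j)) ^ q"
    if "i < n" "j < n" for i j
    using arg_cong[OF eq, of "\<lambda>A. A $$ (i, j)"] that M by (simp add: reindex_mat_def)
  have rows: "M $$ (i, j) = (M $$ (0, (j + n - i) mod n)) ^ q ^ i" if "i < n" "j < n" for i j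
    using that
  proof (induction i arbitrary: j)
    case 0
    thus ?case by simp
  next
    case (Suc i)
    have "j \<in> cyclic_succ n ` {0..<n}"
      using Suc.prems by (simp only: permutes_image[OF cyclic_succ_permutes]) simp
    then obtain j' where j': "j' < n" "j = cyclic_succ n j'"
      by (auto simp only: atLeastLessThan_iff)
    have succ_i: "Suc i = cyclic_succ n i"
      using Suc.prems by (simp add: cyclic_succ_def)
    have "i < n"
      using Suc.prems by simp
    have "M $$ (Suc i, j) = (M $$ (i, j')) ^ q"
      unfolding succ_i j'(2) by (rule step[OF \<open>i < n\<close> j'(1)])
    also have "M $$ (i, j') = (M $$ (0, (j' + n - i) mod n)) ^ q ^ i"
      by (rule Suc.IH[OF \<open>i < n\<close> j'(1)])
    also have "(j' + n - i) mod n = (j + n - Suc i) mod n"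
      unfolding succ_i j'(2) by (rule cyclic_succ_diff[OF \<open>i < n\<close> j'(1), symmetric])
    finally show ?case
      by (simp add: mult.commute flip: power_mult)
  qed
  have "M = dickson_mat q n (\<lambda>k. M $$ (0, k))"
  proof (rule eq_matI)
    fix i j
    assume "i < dim_row (dickson_mat q n (\<lambda>k. M $$ (0, k)))"
      "j < dim_col (dickson_mat q n (\<lambda>k. M $$ (0, k)))"
    hence "i < n" "j < n"
      by (simp_all add: dickson_mat_def)
    thus "M $$ (i, j) = dickson_mat q n (\<lambda>k. M $$ (0, k)) $$ (i, j)"
      using rows[of i j] by (simp add: dickson_mat_def)
  qed (use M in \<open>simp_all add: dickson_mat_def\<close>)
  thus "M \<in> dickson_matrices q n"
    unfolding dickson_matrices_def by blast
qed

theorem theorem4p12: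
  fixes q n :: nat and D :: "'a :: {field, finite} mat"
  assumes "primepow q" and "n \<ge> 1" and "CARD('a) = q ^ n"
    and "D \<in> dickson_matrices q n"
  shows "adj_mat D \<in> dickson_matrices q n"
proof -
  let ?\<phi> = "\<lambda>x :: 'a. x ^ q" and ?\<sigma> = "cyclic_succ n"
  interpret comm_ring_hom ?\<phi>
    by (rule frobenius_comm_ring_hom[OF assms(1,3)])
  have "x ^ (q ^ n) = x" for x :: 'a
    using power_card_field[of x] assms(3) by simp
  note dickson_iff = dickson_matrices_iff_reindex_eq_frobenius[OF assms(2) this]
  have D: "D \<in> carrier_mat n n" and eq: "reindex_mat ?\<sigma> D = map_mat ?\<phi> D"
    using assms(4) by (simp_all add: dickson_iff)
  have "reindex_mat ?\<sigma> (adj_mat D) = adj_mat (reindex_mat ?\<sigma> D)"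
    by (rule adj_mat_reindex[OF D cyclic_succ_permutes, symmetric])
  also have "\<dots> = map_mat ?\<phi> (adj_mat D)"
    by (simp only: eq adj_mat_map_mat[OF D])
  finally show ?thesis
    using adj_mat(1)[OF D] by (simp add: dickson_iff)
qed

end
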